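(* Let $(X,\pi;M_X,I_X)$ and $(Y,\sigma;M_Y,I_Y)$ be impulsive semidynamical systems satisfying the standing assumptions. Let $x\in X$, $y\in Y$ and assume that $\tilde L_X^+(x)$ is a nonempty $I_X$-invariant set. If $\mathcal L_x^{+\infty}=\mathcal L_y^{+\infty}$, then there is a weak topological conjugation $h:\tilde L_X^+(x)\to\tilde L_Y^+(y)$.
   Context: Let $\mathbb R_+=[0,+\infty)$. A semidynamical system $(Z,\varrho)$ on a metric space $Z$ is a continuous map $\varrho:Z\times\mathbb R_+\to Z$ with $\varrho(z,0)=z$ and $\varrho(\varrho(z,t),s)=\varrho(z,t+s)$ for all $z\in Z$, $t,s\in\mathbb R_+$. For $z\in Z$, $t\ge 0$ put $F(z,t)=\{w\in Z:\varrho(w,t)=z\}$; for $D\subset Z$, $\Delta\subset[0,+\infty)$ put $F(D,\Delta)=\bigcup_{z\in D,\,t\in\Delta}F(z,t)$ (singletons are written without braces). A point $z$ is an initial point if $F(z,t)=\emptyset$ for all $t>0$. An impulsive semidynamical system (ISS) $(Z,\varrho;M,I)$ consists of a semidynamical system $(Z,\varrho)$, a nonempty closed set $M\subset Z$ such that for every $z\in M$ there is $\epsilon_z>0$ with $F(z,(0,\epsilon_z))\cap M=\emptyset$ and $\varrho(z,(0,\epsilon_z))\cap M=\emptyset$, and a continuous function $I:M\to Z$. Let $\phi(z)\in(0,+\infty]$ be the least $s>0$ with $\varrho(z,s)\in M$, and $\phi(z)=+\infty$ if no such $s$ exists. The impulsive trajectory $\tilde\varrho(z,\cdot)$ of $z$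 is defined inductively: $z_0^+=z$, $t_0=0$; given $z_n^+$ and $t_n$, if $\phi(z_n^+)=+\infty$ then $\tilde\varrho(z,t)=\varrho(z_n^+,t-t_n)$ for all $t\ge t_n$; otherwise let $s_n=\phi(z_n^+)$, $t_{n+1}=t_n+s_n$, $\tilde\varrho(z,t)=\varrho(z_n^+,t-t_n)$ for $t_n\le t<t_{n+1}$, $z_{n+1}=\varrho(z_n^+,s_n)\in M$, $z_{n+1}^+=I(z_{n+1})$, and $\tilde\varrho(z,t_{n+1})=z_{n+1}^+$. Strong Tube Condition (STC): a point $z\in M$ satisfies STC if there are $\lambda>0$ and closed sets $S,L\subset Z$ with $z\in S$ such that $F(L,\lambda)=S$; $F(L,[0,2\lambda])$ is a neighborhood of $z$; $F(L,\mu)\cap F(L,\nu)=\emptyset$ for $0\le\mu<\nu\le 2\lambda$; and $S=M\cap F(L,[0,2\lambda])$. Standing assumptions on every ISS: no initial point of $(Z,\varrho)$ belongs to $M$ and every element of $M$ satisfies STC (consequently $\phi$ is continuous on $Z\setminus M$); $M\cap I(M)=\emptyset$; and $\tilde\varrho(z,t)$ is defined for all $t\ge 0$ and all $z\in Z$. Here $(X,\rho_X)$ and $(Y,\rho_Y)$ are metric spaces, and $\tilde\pi,\tilde\sigma$ denote the impulsive trajectories in $(X,\pi;M_X,I_X)$ and $(Y,\sigma;M_Y,I_Y)$. A set $A\subset X$ is $I_X$-invariant if $I_X(A\cap M_X)\subset A$. The positive limit set $\tilde L_X^+(x)$ is the set of all $q\in X$ for which there is a sequence $\lambda_n\to+\infty$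 in $\mathbb R_+$ with $\tilde\pi(x,\lambda_n)\to q$; $\tilde L_Y^+(y)$ is defined analogously with $\tilde\sigma$. For a system $(Z,\varrho;M,I)$ and $z\in Z$, $\mathcal L_z^{+\infty}$ is the set of sequences $\{t_n\}_{n\in\mathbb N}\subset\mathbb R_+$ with $t_n\to+\infty$ such that $\{\tilde\varrho(z,t_n)\}_{n\in\mathbb N}$ converges to some point of $Z$. Weak topological conjugation: for $A\subset X$ and $B\subset Y$, a mapping $h:A\to B$ is a weak topological conjugation if (a) $h$ is a homeomorphism; (b) $h(\tilde\pi(a,t))=\tilde\sigma(h(a),t)$ for all $a\in A\setminus M_X$ and $t\ge0$; (c) $h(\tilde\pi(I_X(a),t))=\tilde\sigma(h(I_X(a)),t)$ for all $a\in A\cap M_X$ and $t\ge0$ (in particular the points to which $h$ is applied lie in $A$). *)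

theory Defs
  imports "HOL-Analysis.Analysis"
begin

text \<open>
  The half-line of times is represented by the nonnegative reals: a semidynamical system is a
  function \<open>\<rho> :: 'z \<Rightarrow> real \<Rightarrow> 'z\<close> whose values at negative times are irrelevant. Likewise the
  impulse function is a total function \<open>I\<close> of which only the restriction to \<open>M\<close> matters.
\<close>

locale semidynamical_system =
  fixes \<rho> :: "'z::metric_space \<Rightarrow> real \<Rightarrow> 'z"
  assumes continuous: "continuous_on (UNIV \<times> {0..}) (\<lambda>(z, t). \<rho> z t)"
    and at_zero: "\<rho> z 0 = z"
    and semigroup: "0 \<le> t \<Longrightarrow> 0 \<le> s \<Longrightarrow> \<rho> (\<rho> z t) s = \<rho> z (t + s)"

definition past :: "('z \<Rightarrow> real \<Rightarrow> 'z) \<Rightarrow> 'z set \<Rightarrow> real set \<Rightarrow> 'z set" where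
  "past \<rho> D \<Delta> = (\<Union>z\<in>D. \<Union>t\<in>\<Delta>. {w. \<rho> w t = z})"

definition initial_point :: "('z \<Rightarrow> real \<Rightarrow> 'z) \<Rightarrow> 'z \<Rightarrow> bool" where
  "initial_point \<rho> z \<longleftrightarrow> (\<forall>t>0. past \<rho> {z} {t} = {})"

locale impulsive_system = semidynamical_system \<rho>
  for \<rho> :: "'z::metric_space \<Rightarrow> real \<Rightarrow> 'z" +
  fixes M :: "'z set" and I :: "'z \<Rightarrow> 'z"
  assumes M_nonempty: "M \<noteq> {}"
    and M_closed: "closed M"
    and M_isolated: "z \<in> M \<Longrightarrow>
      \<exists>\<epsilon>>0. past \<rho> {z} {0<..<\<epsilon>} \<inter> M = {} \<and> \<rho> z ` {0<..<\<epsilon>} \<inter> M = {}"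
    and I_continuous: "continuous_on M I"

text \<open>In an impulsive system the least hitting time below exists whenever there is any.\<close>

definition hit_time :: "('z \<Rightarrow> real \<Rightarrow> 'z) \<Rightarrow> 'z set \<Rightarrow> 'z \<Rightarrow> ereal" where
  "hit_time \<rho> M z =
     (if \<exists>s>0. \<rho> z s \<in> M then ereal (LEAST s. s > 0 \<and> \<rho> z s \<in> M) else \<infinity>)"

text \<open>
  \<open>impulse_seq \<rho> M I z n = Some (z\<^sub>n\<^sup>+, t\<^sub>n)\<close> if the trajectory of \<open>z\<close> has at least \<open>n\<close>
  impulses, and \<open>None\<close> otherwise.
\<close>

primrec impulse_seq ::
  "('z \<Rightarrow> real \<Rightarrow> 'z) \<Rightarrow> 'z set \<Rightarrow> ('z \<Rightarrow> 'z) \<Rightarrow> 'z \<Rightarrow> nat \<Rightarrow> ('z \<times> real) option" where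
  "impulse_seq \<rho> M I z 0 = Some (z, 0)"
| "impulse_seq \<rho> M I z (Suc n) =
     (case impulse_seq \<rho> M I z n of
        None \<Rightarrow> None
      | Some (p, u) \<Rightarrow>
          if hit_time \<rho> M p = \<infinity> then None
          else let s = real_of_ereal (hit_time \<rho> M p) in Some (I (\<rho> p s), u + s))"

text \<open>
  The graph of the impulsive trajectory of \<open>z\<close>: the pieces
  \<open>[t\<^sub>n, t\<^sub>n + \<phi> z\<^sub>n\<^sup>+)\<close> are pairwise disjoint, but need not cover all nonnegative times, since
  the impulse times may accumulate.
\<close>

definition on_imp_traj ::
  "('z \<Rightarrow> real \<Rightarrow> 'z) \<Rightarrow> 'z set \<Rightarrow> ('z \<Rightarrow> 'z) \<Rightarrow> 'z \<Rightarrow> real \<Rightarrow> 'z \<Rightarrow> bool" where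
  "on_imp_traj \<rho> M I z t w \<longleftrightarrow>
     (\<exists>n p u. impulse_seq \<rho> M I z n = Some (p, u) \<and> u \<le> t \<and>
        ereal t < ereal u + hit_time \<rho> M p \<and> w = \<rho> p (t - u))"

definition imp_traj ::
  "('z \<Rightarrow> real \<Rightarrow> 'z) \<Rightarrow> 'z set \<Rightarrow> ('z \<Rightarrow> 'z) \<Rightarrow> 'z \<Rightarrow> real \<Rightarrow> 'z" where
  "imp_traj \<rho> M I z t = (THE w. on_imp_traj \<rho> M I z t w)"

definition strong_tube_condition ::
  "('z::metric_space \<Rightarrow> real \<Rightarrow> 'z) \<Rightarrow> 'z set \<Rightarrow> 'z \<Rightarrow> bool" where
  "strong_tube_condition \<rho> M z \<longleftrightarrow>
     (\<exists>l>0. \<exists>S L. closed S \<and> closed L \<and> z \<in> S \<and>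
        past \<rho> L {l} = S \<and>
        z \<in> interior (past \<rho> L {0..2 * l}) \<and>
        (\<forall>\<mu> \<nu>. 0 \<le> \<mu> \<and> \<mu> < \<nu> \<and> \<nu> \<le> 2 * l \<longrightarrow> past \<rho> L {\<mu>} \<inter> past \<rho> L {\<nu>} = {}) \<and>
        S = M \<inter> past \<rho> L {0..2 * l})"

locale standing_impulsive_system = impulsive_system \<rho> M I
  for \<rho> :: "'z::metric_space \<Rightarrow> real \<Rightarrow> 'z" and M :: "'z set" and I :: "'z \<Rightarrow> 'z" +
  assumes no_initial_points: "z \<in> M \<Longrightarrow> \<not> initial_point \<rho> z"
    and STC: "z \<in> M \<Longrightarrow> strong_tube_condition \<rho> M z"
    and M_disjoint_image: "M \<inter> I ` M = {}"
    and traj_total: "0 \<le> t \<Longrightarrow> \<exists>w. on_imp_traj \<rho> M I z t w"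

definition impulse_invariant :: "'z set \<Rightarrow> ('z \<Rightarrow> 'z) \<Rightarrow> 'z set \<Rightarrow> bool" where
  "impulse_invariant M I A \<longleftrightarrow> I ` (A \<inter> M) \<subseteq> A"

definition pos_limit_set ::
  "('z::metric_space \<Rightarrow> real \<Rightarrow> 'z) \<Rightarrow> 'z set \<Rightarrow> ('z \<Rightarrow> 'z) \<Rightarrow> 'z \<Rightarrow> 'z set" where
  "pos_limit_set \<rho> M I z =
     {q. \<exists>r :: nat \<Rightarrow> real. (\<forall>n. 0 \<le> r n) \<and> filterlim r at_top sequentially \<and>
           (\<lambda>n. imp_traj \<rho> M I z (r n)) \<longlonglongrightarrow> q}"

definition conv_times ::
  "('z::metric_space \<Rightarrow> real \<Rightarrow> 'z) \<Rightarrow> 'z set \<Rightarrow> ('z \<Rightarrow> 'z) \<Rightarrow> 'z \<Rightarrow> (nat \<Rightarrow> real) set" where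
  "conv_times \<rho> M I z =
     {r. (\<forall>n. 0 \<le> r n) \<and> filterlim r at_top sequentially \<and>
         convergent (\<lambda>n. imp_traj \<rho> M I z (r n))}"

text \<open>
  A map \<open>A \<rightarrow> B\<close> is a total function here, so the requirement that \<open>h\<close> is applied only to points
  of \<open>A\<close> is stated explicitly.
\<close>

definition weak_top_conjugation ::
  "('x::metric_space \<Rightarrow> real \<Rightarrow> 'x) \<Rightarrow> 'x set \<Rightarrow> ('x \<Rightarrow> 'x) \<Rightarrow>
   ('y::metric_space \<Rightarrow> real \<Rightarrow> 'y) \<Rightarrow> 'y set \<Rightarrow> ('y \<Rightarrow> 'y) \<Rightarrow>
   'x set \<Rightarrow> 'y set \<Rightarrow> ('x \<Rightarrow> 'y) \<Rightarrow> bool" where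
  "weak_top_conjugation \<pi> MX IX \<sigma> MY IY A B h \<longleftrightarrow>
     (\<exists>g. homeomorphism A B h g) \<and>
     (\<forall>a \<in> A - MX. \<forall>t\<ge>0.
        imp_traj \<pi> MX IX a t \<in> A \<and>
        h (imp_traj \<pi> MX IX a t) = imp_traj \<sigma> MY IY (h a) t) \<and>
     (\<forall>a \<in> A \<inter> MX. IX a \<in> A \<and>
        (\<forall>t\<ge>0. imp_traj \<pi> MX IX (IX a) t \<in> A \<and>
           h (imp_traj \<pi> MX IX (IX a) t) = imp_traj \<sigma> MY IY (h (IX a)) t))"

end

theory Submission
  imports Defs
begin

text \<open>
  Write \<open>\<psi>\<^sub>X\<close>, \<open>\<psi>\<^sub>Y\<close> for the impulsive trajectories. The conjugation sends \<open>q = lim \<psi>\<^sub>X(x, r\<^sub>n)\<close> to \<open>lim \<psi>\<^sub>Y(y, r\<^sub>n)\<close>; interleaving time sequences shows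
  that this is well defined, and a diagonal choice of times that it is a homeomorphism.

  If \<open>w\<^sub>n \<rightarrow> a\<close> and the hitting times of the \<open>w\<^sub>n\<close> stay away from \<open>0\<close>, then the
  hitting times converge to that of \<open>a\<close>, and the trajectories of \<open>w\<^sub>n\<close> at time \<open>t + \<epsilon>\<^sub>n\<close> converge to that
  of \<open>a\<close> at time \<open>t\<close> for every \<open>\<epsilon>\<^sub>n \<rightarrow> 0\<close> above a threshold \<open>\<eta>\<^sub>n \<rightarrow> 0\<close>, which absorbs the delay of
  the impulses. For \<open>a \<notin> M\<^sub>X\<close> the assumption on hitting times is automatic. The point \<open>h a\<close> may well
  belong to \<open>M\<^sub>Y\<close>, but the points \<open>\<psi>\<^sub>Y(y, r\<^sub>n)\<close> converging to it cannot have hitting times tending to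
  \<open>0\<close>: a slight delay would send the limit to \<open>I\<^sub>Y(h a) \<noteq> h a\<close>, whereas in \<open>X\<close> a slight delay does not
  change the limit.
\<close>

section \<open>Limits along common time sequences\<close>

lemma filterlim_interleave:
  assumes "filterlim f F sequentially" "filterlim g F sequentially"
  shows "filterlim (\<lambda>n. if even n then f (n div 2) else g (n div 2)) F sequentially"
proof -
  have half: "filterlim (\<lambda>n::nat. n div 2) sequentially sequentially"
    by (rule filterlim_at_top_div_const_nat) simp
  show ?thesis
    by (intro filterlim_If filterlim_mono[OF filterlim_compose[OF assms(1) half]]
          filterlim_mono[OF filterlim_compose[OF assms(2) half]]) (auto simp: le_infI1)
qed

lemma LIMSEQ_interleaved:
  assumes "(\<lambda>n. F (if even n then r (n div 2) else s (n div 2))) \<longlonglongrightarrow> L"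
  shows "(\<lambda>n. F (r n)) \<longlonglongrightarrow> L" "(\<lambda>n. F (s n)) \<longlonglongrightarrow> L"
proof -
  have "strict_mono (\<lambda>n::nat. 2 * n)" "strict_mono (\<lambda>n::nat. 2 * n + 1)"
    by (auto simp: strict_mono_def)
  from this[THEN LIMSEQ_subseq_LIMSEQ[OF assms]]
  show "(\<lambda>n. F (r n)) \<longlonglongrightarrow> L" "(\<lambda>n. F (s n)) \<longlonglongrightarrow> L"
    by (simp_all add: o_def)
qed

lemma tendsto_near:
  fixes a b :: "'i \<Rightarrow> 'a::metric_space"
  assumes "(a \<longlongrightarrow> l) F" "(d \<longlongrightarrow> 0) F" "\<And>n. dist (b n) (a n) \<le> d n"
  shows "(b \<longlongrightarrow> l) F"
proof (rule tendsto_dist_iff[THEN iffD2], rule tendsto_sandwich[OF _ _ tendsto_const])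
  show "((\<lambda>n. d n + dist (a n) l) \<longlongrightarrow> 0) F"
    using tendsto_add[OF assms(2) tendsto_dist[OF assms(1) tendsto_const, of l]] by simp
  show "\<forall>\<^sub>F n in F. dist (b n) l \<le> d n + dist (a n) l"
  proof (intro always_eventually allI)
    show "dist (b n) l \<le> d n + dist (a n) l" for n
      using dist_triangle[of "b n" l "a n"] assms(3)[of n] by linarith
  qed
qed simp

definition time_seq :: "(nat \<Rightarrow> real) \<Rightarrow> bool" where
  "time_seq r \<longleftrightarrow> (\<forall>n. 0 \<le> r n) \<and> filterlim r at_top sequentially"

lemma time_seq_add:
  assumes "time_seq r" "\<And>n. 0 \<le> d n"
  shows "time_seq (\<lambda>n. r n + d n)"
  using assms unfolding time_seq_def
  by (auto intro: filterlim_at_top_mono)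

text \<open>Formulated for an arbitrary function of time, since the homeomorphism is built without
  any dynamics; for an impulsive trajectory this is the positive limit set.\<close>

definition limit_points :: "(real \<Rightarrow> 'a::metric_space) \<Rightarrow> 'a set" where
  "limit_points f = {q. \<exists>r. time_seq r \<and> (\<lambda>n. f (r n)) \<longlonglongrightarrow> q}"

text \<open>Convergence is transferred in one direction only, so that the lemma can be used twice,
  with \<open>f\<close> and \<open>g\<close> exchanged, to get a map and its inverse.\<close>

lemma limit_map_exists:
  fixes f :: "real \<Rightarrow> 'a::metric_space" and g :: "real \<Rightarrow> 'b::metric_space"
  assumes conv: "\<And>r. time_seq r \<Longrightarrow> convergent (\<lambda>n. f (r n)) \<Longrightarrow> convergent (\<lambda>n. g (r n))"
  obtains h where
    "\<And>r q. time_seq r \<Longrightarrow> (\<lambda>n. f (r n)) \<longlonglongrightarrow> q \<Longrightarrow> (\<lambda>n. g (r n)) \<longlonglongrightarrow> h q"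
    "continuous_on (limit_points f) h"
proof -
  \<comment> \<open>The interleaving of \<open>r\<close> and \<open>s\<close> is a time sequence
    along which \<open>f\<close> tends to \<open>q\<close>; so \<open>g\<close> converges along it,
    and both halves inherit the limit.\<close>
  have agree: "(\<lambda>n. g (s n)) \<longlonglongrightarrow> L"
    if "time_seq r" "(\<lambda>n. f (r n)) \<longlonglongrightarrow> q" "time_seq s" "(\<lambda>n. f (s n)) \<longlonglongrightarrow> q"
      "(\<lambda>n. g (r n)) \<longlonglongrightarrow> L" for r s q L
  proof -
    let ?u = "\<lambda>n. if even n then r (n div 2) else s (n div 2)"
    have "time_seq ?u"
      using that(1,3) filterlim_interleave[of r at_top s] unfolding time_seq_def by simp
    moreover have "(\<lambda>n. f (?u n)) \<longlonglongrightarrow> q"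
      using filterlim_interleave[OF that(2,4)] by (simp add: if_distrib)
    ultimately obtain L' where "(\<lambda>n. g (?u n)) \<longlonglongrightarrow> L'"
      using conv unfolding convergent_def by blast
    from LIMSEQ_interleaved[OF this] that(5) show ?thesis
      using LIMSEQ_unique by blast
  qed
  \<comment> \<open>Outside \<open>limit_points f\<close> any value serves, which makes
    \<open>h\<close> total.\<close>
  have "\<exists>L. \<forall>r. time_seq r \<longrightarrow> (\<lambda>n. f (r n)) \<longlonglongrightarrow> q \<longrightarrow> (\<lambda>n. g (r n)) \<longlonglongrightarrow> L" for q
  proof (cases "q \<in> limit_points f")
    case True
    then obtain r where r: "time_seq r" "(\<lambda>n. f (r n)) \<longlonglongrightarrow> q"
      unfolding limit_points_def by blast
    then obtain L where "(\<lambda>n. g (r n)) \<longlonglongrightarrow> L"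
      using conv unfolding convergent_def by blast
    with agree r show ?thesis by blast
  qed (auto simp: limit_points_def)
  then obtain h where
    h: "\<And>q r. time_seq r \<Longrightarrow> (\<lambda>n. f (r n)) \<longlonglongrightarrow> q \<Longrightarrow> (\<lambda>n. g (r n)) \<longlonglongrightarrow> h q"
    by metis
  have "(h \<circ> p) \<longlonglongrightarrow> h q"
    if p: "\<forall>k. p k \<in> limit_points f" "p \<longlonglongrightarrow> q" for p q
  proof -
    \<comment> \<open>A limit point \<open>p k\<close> need not be a value of \<open>f\<close>, so
      it is replaced by a nearby \<open>f (T k)\<close>; the same time brings \<open>g (T k)\<close>
      close to \<open>h (p k)\<close>, and \<open>real k \<le> T k\<close> makes \<open>T\<close> a
      time sequence.\<close>
    have "\<exists>T. real k \<le> T \<and> dist (f T) (p k) < 1 / real (Suc k) \<and> dist (g T) (h (p k)) < 1 / real (Suc k)"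
      for k
    proof -
      from p obtain r where r: "time_seq r" "(\<lambda>n. f (r n)) \<longlonglongrightarrow> p k"
        unfolding limit_points_def by blast
      have "\<forall>\<^sub>F n in sequentially. real k \<le> r n"
        using r(1) by (simp add: time_seq_def filterlim_at_top)
      moreover have "\<forall>\<^sub>F n in sequentially. dist (f (r n)) (p k) < 1 / real (Suc k)"
        by (rule tendstoD[OF r(2)]) simp
      moreover have "\<forall>\<^sub>F n in sequentially. dist (g (r n)) (h (p k)) < 1 / real (Suc k)"
        by (rule tendstoD[OF h[OF r]]) simp
      ultimately have "\<forall>\<^sub>F n in sequentially. real k \<le> r n \<and> dist (f (r n)) (p k) < 1 / real (Suc k)
          \<and> dist (g (r n)) (h (p k)) < 1 / real (Suc k)"
        by eventually_elim blast
      then show ?thesis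
        using eventually_happens'[OF sequentially_bot] by blast
    qed
    then obtain T where T: "\<And>k. real k \<le> T k" "\<And>k. dist (f (T k)) (p k) < 1 / real (Suc k)"
      "\<And>k. dist (g (T k)) (h (p k)) < 1 / real (Suc k)"
      by metis
    have small: "(\<lambda>k. 1 / real (Suc k)) \<longlonglongrightarrow> 0"
      using LIMSEQ_inverse_real_of_nat by (simp add: inverse_eq_divide)
    have "time_seq T"
      unfolding time_seq_def
    proof (intro conjI allI)
      show "0 \<le> T k" for k
        using T(1)[of k] by linarith
      show "filterlim T at_top sequentially"
        by (rule filterlim_at_top_mono[OF filterlim_real_sequentially]) (simp add: T(1))
    qed
    moreover have "(\<lambda>k. f (T k)) \<longlonglongrightarrow> q"
      by (rule tendsto_near[OF p(2) small less_imp_le[OF T(2)]])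
    ultimately have "(\<lambda>k. g (T k)) \<longlonglongrightarrow> h q"
      by (rule h)
    then show ?thesis
      unfolding o_def
      by (rule tendsto_near[OF _ small]) (use T(3) in \<open>simp add: less_imp_le dist_commute del: of_nat_Suc\<close>)
  qed
  then have "continuous_on (limit_points f) h"
    unfolding continuous_on_sequentially by blast
  with h that show thesis by blast
qed

lemma homeomorphism_limit_points:
  fixes f :: "real \<Rightarrow> 'a::metric_space" and g :: "real \<Rightarrow> 'b::metric_space"
  assumes conv: "\<And>r. time_seq r \<Longrightarrow> convergent (\<lambda>n. f (r n)) \<longleftrightarrow> convergent (\<lambda>n. g (r n))"
  obtains h k where "homeomorphism (limit_points f) (limit_points g) h k"
    "\<And>r q. time_seq r \<Longrightarrow> (\<lambda>n. f (r n)) \<longlonglongrightarrow> q \<Longrightarrow> (\<lambda>n. g (r n)) \<longlonglongrightarrow> h q"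
proof -
  obtain h where h: "\<And>r q. time_seq r \<Longrightarrow> (\<lambda>n. f (r n)) \<longlonglongrightarrow> q \<Longrightarrow> (\<lambda>n. g (r n)) \<longlonglongrightarrow> h q"
    and h_cont: "continuous_on (limit_points f) h"
    using limit_map_exists[of f g] conv by blast
  obtain k where k: "\<And>r q. time_seq r \<Longrightarrow> (\<lambda>n. g (r n)) \<longlonglongrightarrow> q \<Longrightarrow> (\<lambda>n. f (r n)) \<longlonglongrightarrow> k q"
    and k_cont: "continuous_on (limit_points g) k"
    using limit_map_exists[of g f] conv by blast
  have hA: "h q \<in> limit_points g \<and> k (h q) = q" if "q \<in> limit_points f" for q
    using that h k LIMSEQ_unique unfolding limit_points_def by blast
  have kB: "k q \<in> limit_points f \<and> h (k q) = q" if "q \<in> limit_points g" for q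
    using that h k LIMSEQ_unique unfolding limit_points_def by blast
  have "homeomorphism (limit_points f) (limit_points g) h k"
    by (rule homeomorphismI) (use h_cont k_cont hA kB in auto)
  with h that show thesis by blast
qed

section \<open>Impulsive trajectories\<close>

context semidynamical_system
begin

lemma tendsto_flow:
  assumes "(w \<longlongrightarrow> a) F" "(u \<longlongrightarrow> t) F" "\<forall>\<^sub>F n in F. 0 \<le> u n" "0 \<le> t"
  shows "((\<lambda>n. \<rho> (w n) (u n)) \<longlongrightarrow> \<rho> a t) F"
  using continuous_on_tendsto_compose[OF continuous tendsto_Pair[OF assms(1,2)]] assms(3,4)
  by simp

text \<open>The pairs in \<open>UNIV \<times> K\<close> that the flow sends into \<open>C\<close>
  form a closed set missing \<open>{a} \<times> K\<close>, so by compactness of \<open>K\<close> a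
  whole \<open>U \<times> K\<close> misses it. Applied with \<open>M\<close> and with the section
  \<open>L\<close> of a tube as \<open>C\<close>.\<close>

lemma eventually_flow_avoids:
  assumes w: "(w \<longlongrightarrow> a) F" and "closed C" "compact K" "K \<subseteq> {0..}"
    and avoid: "\<And>t. t \<in> K \<Longrightarrow> \<rho> a t \<notin> C"
  shows "\<forall>\<^sub>F n in F. \<forall>t\<in>K. \<rho> (w n) t \<notin> C"
proof -
  have "continuous_on (UNIV \<times> K) (\<lambda>(z, t). \<rho> z t)"
    by (rule continuous_on_subset[OF continuous]) (use assms in auto)
  then have "closed ((UNIV \<times> K) \<inter> (\<lambda>(z, t). \<rho> z t) -` C)"
    by (intro continuous_closed_preimage closed_Times compact_imp_closed assms closed_UNIV)
  then have "open (- ((UNIV \<times> K) \<inter> (\<lambda>(z, t). \<rho> z t) -` C))"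
    by (rule open_Compl)
  moreover have "{a} \<times> K \<subseteq> - ((UNIV \<times> K) \<inter> (\<lambda>(z, t). \<rho> z t) -` C)"
    using avoid by auto
  ultimately  obtain U where U: "a \<in> U" "open U" "U \<times> K \<subseteq> - ((UNIV \<times> K) \<inter> (\<lambda>(z, t). \<rho> z t) -` C)"
    using Elementary_Topology.tube_lemma[OF \<open>compact K\<close>] by metis
  have "\<forall>\<^sub>F n in F. w n \<in> U"
    using w U by (simp add: topological_tendstoD)
  then show ?thesis
    by eventually_elim (use U(3) in auto)
qed

end

section \<open>First hitting times\<close>

context impulsive_system
begin

abbreviation hit ("\<phi>") where "\<phi> \<equiv> hit_time \<rho> M"

abbreviation traj ("\<psi>") where "\<psi> \<equiv> imp_traj \<rho> M I"

lemma no_immediate_hit: "\<exists>\<epsilon>>0. \<forall>u. 0 < u \<and> u < \<epsilon> \<longrightarrow> \<rho> z u \<notin> M"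
proof (cases "z \<in> M")
  case True
  then show ?thesis
    using M_isolated[of z] by fastforce
next
  case False
  have "((\<lambda>u. \<rho> z u) \<longlongrightarrow> \<rho> z 0) (at_right 0)"
    by (rule tendsto_flow) (auto simp: eventually_at intro: exI[of _ 1])
  moreover have "\<rho> z 0 \<in> - M" "open (- M)"
    using False M_closed by (auto simp: at_zero)
  ultimately have "\<forall>\<^sub>F u in at_right 0. \<rho> z u \<in> - M"
    using topological_tendstoD by blast
  then show ?thesis
    by (auto simp: eventually_at_right_field)
qed

text \<open>\<open>LEAST\<close> over the reals is meaningful only once a minimum exists. Hits
  cannot accumulate at 0 by \<open>no_immediate_hit\<close>, so those up to \<open>s\<close> form a
  closed subset of the compact interval \<open>{\<epsilon>..s}\<close>.\<close>

lemma hit_time_attained: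
  assumes "0 < s" "\<rho> z s \<in> M"
  obtains l where "\<phi> z = ereal l" "0 < l" "\<rho> z l \<in> M" "\<And>u. 0 < u \<Longrightarrow> \<rho> z u \<in> M \<Longrightarrow> l \<le> u"
proof -
  obtain \<epsilon> where \<epsilon>: "\<epsilon> > 0" "\<And>u. 0 < u \<Longrightarrow> u < \<epsilon> \<Longrightarrow> \<rho> z u \<notin> M"
    using no_immediate_hit by blast
  have "continuous_on {\<epsilon>..s} (\<rho> z)"
    unfolding continuous_on_def
    by (intro ballI tendsto_flow) (use \<epsilon> in \<open>auto simp: eventually_at_filter intro: always_eventually\<close>)
  then have "closed ({\<epsilon>..s} \<inter> \<rho> z -` M)"
    by (intro continuous_closed_preimage M_closed) auto
  then have "compact ({\<epsilon>..s} \<inter> ({\<epsilon>..s} \<inter> \<rho> z -` M))"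
    by (rule compact_Int_closed[OF compact_Icc])
  moreover have "s \<in> {\<epsilon>..s} \<inter> ({\<epsilon>..s} \<inter> \<rho> z -` M)"
    using assms \<epsilon>(2)[of s] by (cases "s < \<epsilon>") auto
  ultimately obtain l where l: "l \<in> {\<epsilon>..s} \<inter> ({\<epsilon>..s} \<inter> \<rho> z -` M)"
    and least: "\<And>u. u \<in> {\<epsilon>..s} \<inter> ({\<epsilon>..s} \<inter> \<rho> z -` M) \<Longrightarrow> l \<le> u"
    using compact_attains_inf by (metis empty_iff)
  have l_le: "l \<le> u" if "0 < u" "\<rho> z u \<in> M" for u
    using that least[of u] \<epsilon>(2)[of u] l by (cases "u \<le> s"; cases "u < \<epsilon>") auto
  have "(LEAST s. s > 0 \<and> \<rho> z s \<in> M) = l"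
    by (rule Least_equality) (use l \<epsilon>(1) l_le in auto)
  then have "\<phi> z = ereal l"
    using assms by (auto simp: hit_time_def)
  with l \<epsilon>(1) l_le that show thesis by auto
qed

lemma hit_time_le: "0 < u \<Longrightarrow> \<rho> z u \<in> M \<Longrightarrow> \<phi> z \<le> ereal u"
  by (rule hit_time_attained) auto

lemma hit_time_cases:
  obtains (infinite) "\<phi> z = \<infinity>" | (finite) s where "\<phi> z = ereal s" "0 < s" "\<rho> z s \<in> M"
proof (cases "\<exists>s>0. \<rho> z s \<in> M")
  case True
  then show thesis using hit_time_attained finite by metis
next
  case False
  then show thesis using infinite by (simp add: hit_time_def)
qed

lemma hit_time_pos: "0 < \<phi> z"
  by (cases z rule: hit_time_cases) auto

lemma hit_in_M: "\<phi> z = ereal s \<Longrightarrow> 0 < s \<and> \<rho> z s \<in> M"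
  by (cases z rule: hit_time_cases) auto

lemma before_hit: "0 < u \<Longrightarrow> ereal u < \<phi> z \<Longrightarrow> \<rho> z u \<notin> M"
  using hit_time_le by (meson not_le)

lemma hit_time_flow:
  assumes "0 \<le> t" "ereal t < \<phi> z"
  shows "\<phi> z = ereal t + \<phi> (\<rho> z t)"
proof (rule antisym)
  show "\<phi> z \<le> ereal t + \<phi> (\<rho> z t)"
  proof (cases "\<rho> z t" rule: hit_time_cases)
    case (finite s)
    then show ?thesis
      using assms hit_time_le[of "t + s" z] by (simp add: semigroup)
  qed simp
  show "ereal t + \<phi> (\<rho> z t) \<le> \<phi> z"
  proof (cases z rule: hit_time_cases)
    case (finite s)
    then have "\<phi> (\<rho> z t) \<le> ereal (s - t)"
      using assms by (intro hit_time_le) (auto simp: semigroup)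
    then show ?thesis
      using finite by (cases "\<phi> (\<rho> z t)") auto
  qed simp
qed

section \<open>Unfolding a trajectory at its first impulse\<close>

lemma impulse_seq_nonneg: "impulse_seq \<rho> M I z n = Some (p, u) \<Longrightarrow> 0 \<le> u"
proof (induction n arbitrary: p u)
  case (Suc n)
  then obtain p' u' where prev: "impulse_seq \<rho> M I z n = Some (p', u')" "\<phi> p' \<noteq> \<infinity>"
    "u = u' + real_of_ereal (\<phi> p')"
    by (auto simp: Let_def split: option.splits if_splits)
  then show ?case
    using Suc.IH[OF prev(1)] hit_time_pos[of p'] by (simp add: real_of_ereal_pos)
qed simp

text \<open>The recursion of \<open>impulse_seq\<close> adds impulses at the end; this splits off
  the first one, so that trajectories can be followed from their start.\<close>

lemma impulse_seq_shift:
  assumes "\<phi> z = ereal s"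
  shows "impulse_seq \<rho> M I z (Suc n) = map_option (\<lambda>(p, u). (p, u + s)) (impulse_seq \<rho> M I (I (\<rho> z s)) n)"
proof (induction n)
  case 0
  then show ?case using assms by simp
next
  case (Suc n)
  then show ?case
    by (subst impulse_seq.simps(2), subst Suc.IH) (auto simp: Let_def split: option.splits)
qed

lemma impulse_seq_no_hit: "\<phi> z = \<infinity> \<Longrightarrow> impulse_seq \<rho> M I z (Suc n) = None"
  by (induction n) auto

lemma on_imp_traj_before_hit:
  assumes "0 \<le> t" "ereal t < \<phi> z"
  shows "on_imp_traj \<rho> M I z t w \<longleftrightarrow> w = \<rho> z t"
proof
  assume "on_imp_traj \<rho> M I z t w"
  then obtain n p u where n: "impulse_seq \<rho> M I z n = Some (p, u)" "u \<le> t" "w = \<rho> p (t - u)"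
    unfolding on_imp_traj_def by blast
  show "w = \<rho> z t"
  proof (cases n)
    case 0
    with n show ?thesis by simp
  next
    case (Suc m)
    with n impulse_seq_no_hit obtain s where s: "\<phi> z = ereal s"
      by (cases z rule: hit_time_cases) auto
    \<comment> \<open>Pieces after the first impulse start no earlier than \<open>s\<close>, whereas
      \<open>t < s\<close>.\<close>
    with n Suc have "s \<le> u"
      by (auto simp: impulse_seq_shift simp del: impulse_seq.simps dest: impulse_seq_nonneg)
    with assms s n show ?thesis by simp
  qed
next
  assume "w = \<rho> z t"
  with assms show "on_imp_traj \<rho> M I z t w"
    unfolding on_imp_traj_def by (intro exI[of _ 0]) (simp flip: zero_ereal_def)
qed

lemma on_imp_traj_after_hit:
  assumes "\<phi> z = ereal s" "s \<le> t"
  shows "on_imp_traj \<rho> M I z t w \<longleftrightarrow> on_imp_traj \<rho> M I (I (\<rho> z s)) (t - s) w"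
proof
  assume "on_imp_traj \<rho> M I z t w"
  then obtain n p u where n: "impulse_seq \<rho> M I z n = Some (p, u)" "u \<le> t"
    "ereal t < ereal u + \<phi> p" "w = \<rho> p (t - u)"
    unfolding on_imp_traj_def by blast
  with assms obtain m where m: "n = Suc m"
    by (cases n) (auto simp flip: zero_ereal_def)
  with n obtain v where v: "impulse_seq \<rho> M I (I (\<rho> z s)) m = Some (p, v)" "u = v + s"
    by (auto simp: impulse_seq_shift[OF assms(1)] simp del: impulse_seq.simps)
  with n show "on_imp_traj \<rho> M I (I (\<rho> z s)) (t - s) w"
    unfolding on_imp_traj_def
    by (intro exI[of _ m] exI[of _ p] exI[of _ v]; cases "\<phi> p") (auto simp: algebra_simps)
next
  assume "on_imp_traj \<rho> M I (I (\<rho> z s)) (t - s) w"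
  then obtain n p u where n: "impulse_seq \<rho> M I (I (\<rho> z s)) n = Some (p, u)" "u \<le> t - s"
    "ereal (t - s) < ereal u + \<phi> p" "w = \<rho> p (t - s - u)"
    unfolding on_imp_traj_def by blast
  then have "impulse_seq \<rho> M I z (Suc n) = Some (p, u + s)"
    by (simp add: impulse_seq_shift[OF assms(1)] del: impulse_seq.simps)
  with n show "on_imp_traj \<rho> M I z t w"
    unfolding on_imp_traj_def
    by (intro exI[of _ "Suc n"] exI[of _ p] exI[of _ "u + s"]; cases "\<phi> p")
      (auto simp: algebra_simps simp del: impulse_seq.simps)
qed

lemma traj_before_hit: "0 \<le> t \<Longrightarrow> ereal t < \<phi> z \<Longrightarrow> \<psi> z t = \<rho> z t"
  by (simp add: imp_traj_def on_imp_traj_before_hit)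

text \<open>The two defining predicates coincide, hence so do the points that \<open>THE\<close>
  describes, without a uniqueness argument.\<close>

lemma traj_after_hit: "\<phi> z = ereal s \<Longrightarrow> s \<le> t \<Longrightarrow> \<psi> z t = \<psi> (I (\<rho> z s)) (t - s)"
  by (simp add: imp_traj_def on_imp_traj_after_hit)

lemma traj_zero: "\<psi> z 0 = z"
  using traj_before_hit[of 0 z] hit_time_pos[of z] by (simp add: at_zero zero_ereal_def)

text \<open>The orbit of \<open>a\<close> avoids \<open>M\<close> on a compact interval of times
  that includes 0, where \<open>a \<notin> M\<close> enters, and so do nearby orbits.\<close>

lemma hit_time_bounded_below:
  assumes w: "(w \<longlongrightarrow> a) F" and "a \<notin> M"
  shows "\<exists>\<delta>>0. \<forall>\<^sub>F n in F. ereal \<delta> \<le> \<phi> (w n)"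
proof -
  obtain \<epsilon> where \<epsilon>: "\<epsilon> > 0" "\<And>u. 0 < u \<Longrightarrow> u < \<epsilon> \<Longrightarrow> \<rho> a u \<notin> M"
    using no_immediate_hit by blast
  have "\<rho> a t \<notin> M" if "t \<in> {0..\<epsilon>/2}" for t
    using that \<epsilon> \<open>a \<notin> M\<close> at_zero[of a] by (cases "t = 0") auto
  then have "\<forall>\<^sub>F n in F. \<forall>t\<in>{0..\<epsilon>/2}. \<rho> (w n) t \<notin> M"
    by (intro eventually_flow_avoids[OF w M_closed]) auto
  then have "\<forall>\<^sub>F n in F. ereal (\<epsilon>/2) \<le> \<phi> (w n)"
  proof eventually_elim
    case (elim n)
    show ?case
    proof (cases "w n" rule: hit_time_cases)
      case (finite s)
      with elim show ?thesis by (cases "s \<le> \<epsilon>/2") auto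
    qed simp
  qed
  with \<epsilon>(1) show ?thesis
    by (intro exI[of _ "\<epsilon>/2"]) simp
qed

end

section \<open>Induction over impulses, semigroup law, continuity of hitting times\<close>

context standing_impulsive_system
begin

text \<open>By \<open>traj_total\<close>, time \<open>t\<close> is reached after finitely many
  impulses; the induction runs on their number, which drops by one when the trajectory is restarted
  after its first impulse.\<close>

lemma traj_induct [consumes 1, case_names before after]:
  assumes "0 \<le> t"
    and before: "\<And>z t. 0 \<le> t \<Longrightarrow> ereal t < \<phi> z \<Longrightarrow> P z t"
    and after: "\<And>z s t. \<phi> z = ereal s \<Longrightarrow> s \<le> t \<Longrightarrow> P (I (\<rho> z s)) (t - s) \<Longrightarrow> P z t"
  shows "P z t"
proof -
  have "P z t" if "impulse_seq \<rho> M I z n = Some (p, u)" "u \<le> t" "ereal t < ereal u + \<phi> p" "0 \<le> t"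
    for n p u z t
    using that
  proof (induction n arbitrary: z u t)
    case 0
    then show ?case using before by (simp flip: zero_ereal_def)
  next
    case (Suc n)
    with impulse_seq_no_hit obtain s where s: "\<phi> z = ereal s"
      by (cases z rule: hit_time_cases) (auto simp del: impulse_seq.simps)
    with Suc.prems(1) obtain v where v: "impulse_seq \<rho> M I (I (\<rho> z s)) n = Some (p, v)" "u = v + s"
      by (auto simp: impulse_seq_shift simp del: impulse_seq.simps)
    have "0 \<le> v"
      using v impulse_seq_nonneg by blast
    have "P (I (\<rho> z s)) (t - s)"
      by (rule Suc.IH[OF v(1)]) (use Suc.prems v \<open>0 \<le> v\<close> in \<open>cases "\<phi> p"; auto\<close>)+
    then show ?case
      by (rule after[OF s, rotated]) (use Suc.prems v \<open>0 \<le> v\<close> in auto)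
  qed
  with traj_total[OF \<open>0 \<le> t\<close>, of z] \<open>0 \<le> t\<close> show ?thesis
    unfolding on_imp_traj_def by blast
qed

text \<open>In the base case the first hit of \<open>\<rho> z r\<close> is, by
  \<open>hit_time_flow\<close>, the first hit of \<open>z\<close>; from there on both sides continue
  from the same image point, so no induction on \<open>t\<close> is required.\<close>

lemma traj_semigroup:
  assumes "0 \<le> r" "0 \<le> t"
  shows "\<psi> (\<psi> z r) t = \<psi> z (r + t)"
  using assms(1)
proof (induction z r rule: traj_induct)
  case (before z r)
  have eq: "\<phi> z = ereal r + \<phi> (\<rho> z r)"
    using before by (rule hit_time_flow)
  show ?case
  proof (cases "ereal t < \<phi> (\<rho> z r)")
    case True
    then have "ereal (r + t) < \<phi> z"
      unfolding eq by (cases "\<phi> (\<rho> z r)") auto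
    with True before assms(2) show ?thesis
      by (simp add: traj_before_hit semigroup)
  next
    case False
    then obtain s where s: "\<phi> (\<rho> z r) = ereal s" "0 < s" "s \<le> t"
      by (cases "\<rho> z r" rule: hit_time_cases) auto
    with eq have "\<phi> z = ereal (r + s)"
      by simp
    with s before show ?thesis
      by (simp add: traj_before_hit traj_after_hit semigroup)
  qed
next
  case (after z s r)
  then show ?case
    using assms(2) by (simp add: traj_after_hit algebra_simps)
qed

text \<open>Inside the tube around the hit point \<open>\<rho> a s\<close>, the set \<open>M\<close>
  consists exactly of the points that reach \<open>L\<close> after time \<open>l\<close>. A nearby
  \<open>\<rho> (w n) s\<close> reaches \<open>L\<close> after some \<open>\<mu>\<close> close to
  \<open>l\<close>, so the orbit of \<open>w n\<close> meets \<open>M\<close> at time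
  \<open>s + \<mu> - l\<close>.\<close>

lemma eventually_hit_before:
  assumes w: "(w \<longlongrightarrow> a) F" and s: "\<phi> a = ereal s" and "s < c"
  shows "\<forall>\<^sub>F n in F. \<phi> (w n) < ereal c"
proof -
  have "0 < s" "\<rho> a s \<in> M"
    using hit_in_M[OF s] by auto
  then obtain l S L where stc: "l > 0" "closed L" "\<rho> a s \<in> S" "past \<rho> L {l} = S"
    "\<rho> a s \<in> interior (past \<rho> L {0..2 * l})"
    "\<And>\<mu> \<nu>. 0 \<le> \<mu> \<Longrightarrow> \<mu> < \<nu> \<Longrightarrow> \<nu> \<le> 2 * l \<Longrightarrow> past \<rho> L {\<mu>} \<inter> past \<rho> L {\<nu>} = {}"
    "S = M \<inter> past \<rho> L {0..2 * l}"
    using STC unfolding strong_tube_condition_def by metis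
  have in_past: "z \<in> past \<rho> L {\<mu>} \<longleftrightarrow> \<rho> z \<mu> \<in> L" for z \<mu>
    by (auto simp: past_def)
  \<comment> \<open>Bounds the deviation of \<open>\<mu>\<close> from \<open>l\<close>:
    \<open>e \<le> s\<close> keeps \<open>s + \<mu> - l\<close> positive and
    \<open>e \<le> c - s\<close> keeps it below \<open>c\<close>.\<close>
  define e where "e = Min {s, l, c - s}"
  have e: "0 < e" "e \<le> s" "e \<le> l" "e \<le> c - s"
    using stc(1) \<open>0 < s\<close> \<open>s < c\<close> by (auto simp: e_def)
  let ?v = "\<lambda>n. \<rho> (w n) s"
  have v: "(?v \<longlongrightarrow> \<rho> a s) F"
    using w \<open>0 < s\<close> by (intro tendsto_flow) auto
  then have "\<forall>\<^sub>F n in F. ?v n \<in> interior (past \<rho> L {0..2 * l})"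
    using stc(5) topological_tendstoD by blast
  \<comment> \<open>\<open>\<rho> a s\<close> reaches \<open>L\<close> at no time in
    \<open>{0..2 * l}\<close> other than \<open>l\<close>, so times at distance at least
    \<open>e\<close> from \<open>l\<close> are ruled out for nearby points too.\<close>
  moreover have "\<forall>\<^sub>F n in F. \<forall>\<mu>\<in>{0..l - e} \<union> {l + e..2 * l}. \<rho> (?v n) \<mu> \<notin> L"
  proof (rule eventually_flow_avoids[OF v stc(2)])
    fix \<mu> assume \<mu>: "\<mu> \<in> {0..l - e} \<union> {l + e..2 * l}"
    have "\<rho> a s \<in> past \<rho> L {l}"
      using stc by simp
    moreover have "past \<rho> L {\<mu>} \<inter> past \<rho> L {l} = {}"
      using \<mu> e stc(1) stc(6)[of \<mu> l] stc(6)[of l \<mu>] by auto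
    ultimately show "\<rho> (\<rho> a s) \<mu> \<notin> L"
      using in_past by auto
  qed (use e in \<open>auto intro: compact_Un\<close>)
  ultimately show ?thesis
  proof eventually_elim
    case (elim n)
    from elim(1) have "?v n \<in> past \<rho> L {0..2 * l}"
      using interior_subset by blast
    then obtain \<mu> where \<mu>: "0 \<le> \<mu>" "\<mu> \<le> 2 * l" "\<rho> (?v n) \<mu> \<in> L"
      by (auto simp: past_def)
    with elim(2) have "\<not> \<mu> \<le> l - e" "\<not> l + e \<le> \<mu>"
      by auto
    then have near: "l - e < \<mu>" "\<mu> < l + e"
      by linarith+
    then have pos: "0 < s + \<mu> - l"
      using e by linarith
    have "\<rho> (\<rho> (w n) (s + \<mu> - l)) l = \<rho> (?v n) \<mu>"
      using pos stc(1) \<mu>(1) \<open>0 < s\<close> by (simp add: semigroup)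
    with \<mu>(3) have "\<rho> (w n) (s + \<mu> - l) \<in> past \<rho> L {l}"
      by (simp add: in_past)
    then have "\<rho> (w n) (s + \<mu> - l) \<in> M"
      using stc(4,7) by blast
    then have "\<phi> (w n) \<le> ereal (s + \<mu> - l)"
      using pos hit_time_le by blast
    also have "\<dots> < ereal c"
      using near e by simp
    finally show ?case .
  qed
qed

text \<open>Avoidance of \<open>M\<close> on compact intervals gives the lower bound, the tube the
  upper one. The intervals start at \<open>\<delta>\<close> because \<open>a\<close> may lie in
  \<open>M\<close>; earlier hits are excluded by \<open>away\<close>.\<close>

lemma hit_time_tendsto:
  assumes w: "(w \<longlongrightarrow> a) F" and "\<delta> > 0" and away: "\<forall>\<^sub>F n in F. ereal \<delta> \<le> \<phi> (w n)"
  shows "((\<lambda>n. \<phi> (w n)) \<longlongrightarrow> \<phi> a) F"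
proof (rule order_tendstoI)
  fix c assume "c < \<phi> a"
  then obtain c' where c': "c \<le> ereal c'" "ereal c' < \<phi> a"
  proof (cases c)
    case MInf
    then show thesis using that[of 0] hit_time_pos[of a] by (simp add: zero_ereal_def)
  qed (use that in auto)
  have "\<forall>\<^sub>F n in F. \<forall>t\<in>{\<delta>..c'}. \<rho> (w n) t \<notin> M"
  proof (rule eventually_flow_avoids[OF w M_closed])
    fix t assume t: "t \<in> {\<delta>..c'}"
    then have "ereal t \<le> ereal c'" by simp
    with c'(2) have "ereal t < \<phi> a" by (rule le_less_trans[rotated])
    with t \<open>\<delta> > 0\<close> show "\<rho> a t \<notin> M"
      by (intro before_hit) auto
  qed (use \<open>\<delta> > 0\<close> in auto)
  with away show "\<forall>\<^sub>F n in F. c < \<phi> (w n)"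
  proof eventually_elim
    case (elim n)
    have "ereal c' < \<phi> (w n)"
    proof (cases "w n" rule: hit_time_cases)
      case (finite s)
      with elim show ?thesis by (cases "s \<le> c'") auto
    qed simp
    with c'(1) show ?case by (rule le_less_trans)
  qed
next
  fix c assume "\<phi> a < c"
  then obtain s where s: "\<phi> a = ereal s"
    by (cases a rule: hit_time_cases) auto
  with \<open>\<phi> a < c\<close> obtain c' where c': "s < c'" "ereal c' \<le> c"
    by (cases c) (auto intro: that[of "s + 1"])
  from eventually_hit_before[OF w s c'(1)] show "\<forall>\<^sub>F n in F. \<phi> (w n) < c"
    by eventually_elim (use c' in \<open>simp add: less_le_trans\<close>)
qed

section \<open>Convergence of trajectories\<close>

lemma traj_tendsto_before_hit:
  assumes w: "(w \<longlongrightarrow> a) F" and "\<delta> > 0" "\<forall>\<^sub>F n in F. ereal \<delta> \<le> \<phi> (w n)"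
    and "0 \<le> t" "ereal t < \<phi> a" and \<epsilon>: "\<And>n. 0 \<le> \<epsilon> n" "(\<epsilon> \<longlongrightarrow> 0) F"
  shows "((\<lambda>n. \<psi> (w n) (t + \<epsilon> n)) \<longlongrightarrow> \<psi> a t) F"
proof -
  \<comment> \<open>Eventually \<open>c\<close> separates \<open>t + \<epsilon> n\<close> from
    \<open>\<phi> (w n)\<close>, so no impulse has occurred yet.\<close>
  obtain c where c: "ereal t < ereal c" "ereal c < \<phi> a"
    using ereal_dense3[OF \<open>ereal t < \<phi> a\<close>] by auto
  have lim: "((\<lambda>n. t + \<epsilon> n) \<longlongrightarrow> t) F"
    using tendsto_add[OF tendsto_const \<epsilon>(2), of t] by simp
  have "\<forall>\<^sub>F n in F. t + \<epsilon> n < c"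
    using order_tendstoD(2)[OF lim] c by simp
  moreover have "\<forall>\<^sub>F n in F. ereal c < \<phi> (w n)"
    using order_tendstoD(1)[OF hit_time_tendsto[OF assms(1-3)] c(2)] .
  ultimately have "\<forall>\<^sub>F n in F. \<rho> (w n) (t + \<epsilon> n) = \<psi> (w n) (t + \<epsilon> n)"
  proof eventually_elim
    case (elim n)
    then have "ereal (t + \<epsilon> n) < \<phi> (w n)"
      by (meson ereal_less_eq(3) le_less_trans less_imp_le)
    then show ?case
      using \<open>0 \<le> t\<close> \<epsilon>(1)[of n] by (simp add: traj_before_hit)
  qed
  moreover have "((\<lambda>n. \<rho> (w n) (t + \<epsilon> n)) \<longlongrightarrow> \<rho> a t) F"
    using w lim \<epsilon>(1) \<open>0 \<le> t\<close> by (intro tendsto_flow) auto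
  ultimately show ?thesis
    using tendsto_cong assms(4,5) by (simp add: traj_before_hit) (rule Lim_transform_eventually)
qed

text \<open>\<open>real_of_ereal\<close> sends \<open>\<infinity>\<close> to 0; the first claim says
  that this default eventually does not occur.\<close>

lemma hit_jump_tendsto:
  assumes w: "(w \<longlongrightarrow> a) F" and s: "\<phi> a = ereal s" and lim: "((\<lambda>n. \<phi> (w n)) \<longlongrightarrow> \<phi> a) F"
  shows "\<forall>\<^sub>F n in F. \<phi> (w n) = ereal (real_of_ereal (\<phi> (w n)))"
    "((\<lambda>n. real_of_ereal (\<phi> (w n))) \<longlongrightarrow> s) F"
    "((\<lambda>n. I (\<rho> (w n) (real_of_ereal (\<phi> (w n))))) \<longlongrightarrow> I (\<rho> a s)) F"
proof -
  have "\<forall>\<^sub>F n in F. \<phi> (w n) < ereal (s + 1)"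
    using order_tendstoD(2)[OF lim] s by simp
  then show fin: "\<forall>\<^sub>F n in F. \<phi> (w n) = ereal (real_of_ereal (\<phi> (w n)))"
  proof eventually_elim
    case (elim n)
    then show ?case by (cases "w n" rule: hit_time_cases) auto
  qed
  show real: "((\<lambda>n. real_of_ereal (\<phi> (w n))) \<longlongrightarrow> s) F"
    using lim s by simp
  have hits: "\<forall>\<^sub>F n in F. \<rho> (w n) (real_of_ereal (\<phi> (w n))) \<in> M"
    using fin by eventually_elim (use hit_in_M in blast)
  have "((\<lambda>n. \<rho> (w n) (real_of_ereal (\<phi> (w n)))) \<longlongrightarrow> \<rho> a s) F"
    using w real hit_in_M[OF s]
    by (intro tendsto_flow) (auto simp: real_of_ereal_pos hit_time_pos less_imp_le)
  then show "((\<lambda>n. I (\<rho> (w n) (real_of_ereal (\<phi> (w n))))) \<longlongrightarrow> I (\<rho> a s)) F"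
    using continuous_on_tendsto_compose[OF I_continuous] hit_in_M[OF s] hits by blast
qed

text \<open>All vanishing delays above \<open>\<eta>\<close> are allowed because the induction
  shifts delays by the error of an impulse time, and because two systems must later share one
  delay.\<close>

lemma traj_tendsto:
  assumes "0 \<le> t" and "(w \<longlongrightarrow> a) F" and "\<exists>\<delta>>0. \<forall>\<^sub>F n in F. ereal \<delta> \<le> \<phi> (w n)"
  shows "\<exists>\<eta>. (\<forall>n. 0 \<le> \<eta> n) \<and> (\<eta> \<longlongrightarrow> 0) F \<and>
    (\<forall>\<epsilon>. (\<forall>n. \<eta> n \<le> \<epsilon> n) \<longrightarrow> (\<epsilon> \<longlongrightarrow> 0) F \<longrightarrow> ((\<lambda>n. \<psi> (w n) (t + \<epsilon> n)) \<longlongrightarrow> \<psi> a t) F)"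
  using assms
proof (induction a t arbitrary: w rule: traj_induct)
  case (before a t)
  then obtain \<delta> where "\<delta> > 0" "\<forall>\<^sub>F n in F. ereal \<delta> \<le> \<phi> (w n)"
    by blast
  from traj_tendsto_before_hit[OF before(3) this before(1,2)] show ?case
    by (intro exI[of _ "\<lambda>_. 0"]) auto
next
  case (after a s t)
  then obtain \<delta> where \<delta>: "\<delta> > 0" "\<forall>\<^sub>F n in F. ereal \<delta> \<le> \<phi> (w n)"
    by blast
  let ?\<tau> = "\<lambda>n. real_of_ereal (\<phi> (w n))"
  let ?w' = "\<lambda>n. I (\<rho> (w n) (?\<tau> n))"
  note jump = hit_jump_tendsto[OF after.prems(1) after.hyps(1)
      hit_time_tendsto[OF after.prems(1) \<delta>]]
  \<comment> \<open>After an impulse the lower bound on hitting times comes for free, as image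
    points lie outside \<open>M\<close>.\<close>
  have "I (\<rho> a s) \<notin> M"
    using hit_in_M[OF after.hyps(1)] M_disjoint_image by blast
  from after.IH[OF jump(3) hit_time_bounded_below[OF jump(3) this]]
  obtain \<eta> where \<eta>: "\<And>n. 0 \<le> \<eta> n" "(\<eta> \<longlongrightarrow> 0) F"
    "\<And>\<epsilon>. (\<And>n. \<eta> n \<le> \<epsilon> n) \<Longrightarrow> (\<epsilon> \<longlongrightarrow> 0) F \<Longrightarrow>
      ((\<lambda>n. \<psi> (?w' n) (t - s + \<epsilon> n)) \<longlongrightarrow> \<psi> (I (\<rho> a s)) (t - s)) F"
    by blast
  have delay: "((\<lambda>n. ?\<tau> n - s) \<longlongrightarrow> 0) F"
    using jump(2) by (simp add: LIM_zero)
  show ?case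
  \<comment> \<open>\<open>w n\<close> jumps at \<open>?\<tau> n\<close> rather than at
    \<open>s\<close>. Adding the discrepancy to \<open>\<eta>\<close> ensures that
    \<open>w n\<close> has jumped by time \<open>t + \<epsilon> n\<close>, even if
    \<open>t = s\<close>, and that the remaining delay \<open>\<epsilon> n - (?\<tau> n - s)\<close>
    is still at least \<open>\<eta> n\<close>.\<close>
  proof (intro exI[of _ "\<lambda>n. \<eta> n + \<bar>?\<tau> n - s\<bar>"] conjI allI impI)
    show "0 \<le> \<eta> n + \<bar>?\<tau> n - s\<bar>" for n
      using \<eta>(1)[of n] by simp
    show "((\<lambda>n. \<eta> n + \<bar>?\<tau> n - s\<bar>) \<longlongrightarrow> 0) F"
      using tendsto_add[OF \<eta>(2) tendsto_rabs_zero[OF delay]] by simp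
    fix \<epsilon> assume above: "\<forall>n. \<eta> n + \<bar>?\<tau> n - s\<bar> \<le> \<epsilon> n" and "(\<epsilon> \<longlongrightarrow> 0) F"
    have "\<eta> n \<le> \<epsilon> n - (?\<tau> n - s)" for n
      using above[rule_format, of n] by linarith
    moreover have "((\<lambda>n. \<epsilon> n - (?\<tau> n - s)) \<longlongrightarrow> 0) F"
      using tendsto_diff[OF \<open>(\<epsilon> \<longlongrightarrow> 0) F\<close> delay] by simp
    ultimately have "((\<lambda>n. \<psi> (?w' n) (t - s + (\<epsilon> n - (?\<tau> n - s)))) \<longlongrightarrow> \<psi> (I (\<rho> a s)) (t - s)) F"
      by (rule \<eta>(3))
    moreover have "\<forall>\<^sub>F n in F. \<psi> (?w' n) (t - s + (\<epsilon> n - (?\<tau> n - s))) = \<psi> (w n) (t + \<epsilon> n)"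
      using jump(1)
    proof eventually_elim
      case (elim n)
      have "?\<tau> n \<le> t + \<epsilon> n"
        using above[rule_format, of n] \<eta>(1)[of n] after.hyps(2) by linarith
      from traj_after_hit[OF elim this] show ?case
        by (simp add: algebra_simps)
    qed
    ultimately show "((\<lambda>n. \<psi> (w n) (t + \<epsilon> n)) \<longlongrightarrow> \<psi> a t) F"
      using after.hyps by (simp add: traj_after_hit) (rule Lim_transform_eventually)
  qed
qed

section \<open>Excluding hitting times that tend to zero\<close>

lemma traj_at_hit: "\<phi> z = ereal s \<Longrightarrow> \<psi> z s = I (\<rho> z s)"
  by (simp add: traj_after_hit traj_zero)

text \<open>The hypothesis says that small delays do not change the limit \<open>b\<close>.\<close>

lemma hit_time_bounded_below_if_delay_stable:
  assumes w: "w \<longlonglongrightarrow> b"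
    and stable: "\<And>k \<epsilon>. filterlim k sequentially sequentially \<Longrightarrow> (\<And>n. 0 \<le> \<epsilon> n) \<Longrightarrow> \<epsilon> \<longlonglongrightarrow> 0 \<Longrightarrow>
      (\<lambda>n. \<psi> (w (k n)) (\<epsilon> n)) \<longlonglongrightarrow> b"
  shows "\<exists>\<delta>>0. \<forall>\<^sub>F n in sequentially. ereal \<delta> \<le> \<phi> (w n)"
proof (rule ccontr)
  assume neg: "\<not> ?thesis"
  have "\<exists>m\<ge>n. \<phi> (w m) < ereal (1 / real (Suc n))" for n
  proof -
    have "\<not> (\<forall>\<^sub>F m in sequentially. ereal (1 / real (Suc n)) \<le> \<phi> (w m))"
      using neg by (metis of_nat_0_less_iff zero_less_Suc zero_less_divide_1_iff)
    then show ?thesis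
      unfolding eventually_sequentially by (meson not_le)
  qed
  then obtain k where k: "\<And>n. n \<le> k n" "\<And>n. \<phi> (w (k n)) < ereal (1 / real (Suc n))"
    by metis
  have "\<exists>s. \<phi> (w (k n)) = ereal s" for n
    using k(2)[of n] by (cases "w (k n)" rule: hit_time_cases) auto
  then obtain \<epsilon> where \<epsilon>: "\<And>n. \<phi> (w (k n)) = ereal (\<epsilon> n)"
    by metis
  have k_lim: "filterlim k sequentially sequentially"
    by (rule filterlim_at_top_mono[OF filterlim_ident]) (simp add: k(1))
  have pos: "0 \<le> \<epsilon> n" for n
    using hit_in_M[OF \<epsilon>[of n]] by simp
  have "\<epsilon> \<longlonglongrightarrow> 0"
  proof (rule tendsto_sandwich[OF _ _ tendsto_const])
    show "(\<lambda>n. 1 / real (Suc n)) \<longlonglongrightarrow> 0"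
      using LIMSEQ_inverse_real_of_nat by (simp add: inverse_eq_divide)
  qed (use k(2) \<epsilon> pos in \<open>auto intro!: always_eventually less_imp_le\<close>)
  \<comment> \<open>With the hitting time itself as delay, the delayed point is
    \<open>I (?p n)\<close>, while \<open>?p n\<close> tends to \<open>b\<close> because the flow
    runs for a vanishing time. Hence \<open>I b = b\<close> with \<open>b\<close> in
    \<open>M\<close>.\<close>
  let ?p = "\<lambda>n. \<rho> (w (k n)) (\<epsilon> n)"
  have "(\<lambda>n. w (k n)) \<longlonglongrightarrow> b"
    using filterlim_compose[OF w k_lim] .
  then have p: "?p \<longlonglongrightarrow> b"
    using tendsto_flow[of "\<lambda>n. w (k n)" b sequentially \<epsilon> 0] \<open>\<epsilon> \<longlonglongrightarrow> 0\<close> pos by (simp add: at_zero)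
  have pM: "?p n \<in> M" for n
    using hit_in_M[OF \<epsilon>] by blast
  then have "b \<in> M"
    using closed_sequentially[OF M_closed _ p] by blast
  with p pM have "(\<lambda>n. I (?p n)) \<longlonglongrightarrow> I b"
    by (intro continuous_on_tendsto_compose[OF I_continuous] always_eventually) auto
  moreover have "(\<lambda>n. I (?p n)) \<longlonglongrightarrow> b"
    using stable[OF k_lim pos \<open>\<epsilon> \<longlonglongrightarrow> 0\<close>] by (simp add: traj_at_hit[OF \<epsilon>])
  ultimately have "I b = b"
    by (rule LIMSEQ_unique)
  with imageI[OF \<open>b \<in> M\<close>, of I] have "b \<in> M \<inter> I ` M"
    using \<open>b \<in> M\<close> by simp
  then show False
    using M_disjoint_image by simp
qed

end

section \<open>The conjugation\<close>

lemma pos_limit_set_eq: "pos_limit_set \<rho> M I z = limit_points (imp_traj \<rho> M I z)"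
  by (simp add: pos_limit_set_def limit_points_def time_seq_def conj_assoc)

lemma limit_map_conjugates:
  assumes X: "standing_impulsive_system \<pi> MX IX" and Y: "standing_impulsive_system \<sigma> MY IY"
    and h: "\<And>r q. time_seq r \<Longrightarrow> (\<lambda>n. imp_traj \<pi> MX IX x (r n)) \<longlonglongrightarrow> q \<Longrightarrow>
      (\<lambda>n. imp_traj \<sigma> MY IY y (r n)) \<longlonglongrightarrow> h q"
    and a: "a \<in> limit_points (imp_traj \<pi> MX IX x)" "a \<notin> MX" and "0 \<le> t"
  shows "imp_traj \<pi> MX IX a t \<in> limit_points (imp_traj \<pi> MX IX x) \<and>
    h (imp_traj \<pi> MX IX a t) = imp_traj \<sigma> MY IY (h a) t"
proof -
  interpret X: standing_impulsive_system \<pi> MX IX by fact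
  interpret Y: standing_impulsive_system \<sigma> MY IY by fact
  let ?f = "imp_traj \<pi> MX IX" and ?g = "imp_traj \<sigma> MY IY"
  obtain r where r: "time_seq r" and fr: "(\<lambda>n. ?f x (r n)) \<longlonglongrightarrow> a"
    using a unfolding limit_points_def by blast
  have r_nonneg: "0 \<le> r n" for n
    using r by (simp add: time_seq_def)
  have gr: "(\<lambda>n. ?g y (r n)) \<longlonglongrightarrow> h a"
    using h[OF r fr] .
  have bX: "\<exists>\<delta>>0. \<forall>\<^sub>F n in sequentially. ereal \<delta> \<le> hit_time \<pi> MX (?f x (r n))"
    using X.hit_time_bounded_below[OF fr a(2)] .
  \<comment> \<open>Times delayed by a vanishing amount form a time sequence along which the first
    trajectory still tends to \<open>a\<close>, so by \<open>h\<close> the second one still tends to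
    \<open>h a\<close>.\<close>
  have bY: "\<exists>\<delta>>0. \<forall>\<^sub>F n in sequentially. ereal \<delta> \<le> hit_time \<sigma> MY (?g y (r n))"
  proof (rule Y.hit_time_bounded_below_if_delay_stable[OF gr])
    fix k :: "nat \<Rightarrow> nat" and \<epsilon> :: "nat \<Rightarrow> real"
    assume k: "filterlim k sequentially sequentially" and \<epsilon>: "\<And>n. 0 \<le> \<epsilon> n" "\<epsilon> \<longlonglongrightarrow> 0"
    have fk: "(\<lambda>n. ?f x (r (k n))) \<longlonglongrightarrow> a"
      using filterlim_compose[OF fr k] .
    obtain \<delta> where "\<delta> > 0" "\<forall>\<^sub>F n in sequentially. ereal \<delta> \<le> hit_time \<pi> MX (?f x (r (k n)))"
      using X.hit_time_bounded_below[OF fk a(2)] by blast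
    from X.traj_tendsto_before_hit[OF fk this, of 0 \<epsilon>]
    have "(\<lambda>n. ?f (?f x (r (k n))) (\<epsilon> n)) \<longlonglongrightarrow> a"
      using X.hit_time_pos[of a] \<epsilon> by (simp add: zero_ereal_def X.traj_zero)
    then have "(\<lambda>n. ?f x (r (k n) + \<epsilon> n)) \<longlonglongrightarrow> a"
      by (simp add: X.traj_semigroup r_nonneg \<epsilon>(1))
    moreover have "time_seq (\<lambda>n. r (k n))"
      using r filterlim_compose[OF _ k] by (auto simp: time_seq_def)
    then have "time_seq (\<lambda>n. r (k n) + \<epsilon> n)"
      using \<epsilon>(1) by (rule time_seq_add)
    ultimately have "(\<lambda>n. ?g y (r (k n) + \<epsilon> n)) \<longlonglongrightarrow> h a"
      using h by blast
    then show "(\<lambda>n. ?g (?g y (r (k n))) (\<epsilon> n)) \<longlonglongrightarrow> h a"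
      by (simp add: Y.traj_semigroup r_nonneg \<epsilon>(1))
  qed
  obtain \<eta> where \<eta>: "\<And>n. 0 \<le> \<eta> n" "\<eta> \<longlonglongrightarrow> 0"
    "\<And>\<epsilon>. (\<And>n. \<eta> n \<le> \<epsilon> n) \<Longrightarrow> \<epsilon> \<longlonglongrightarrow> 0 \<Longrightarrow> (\<lambda>n. ?f (?f x (r n)) (t + \<epsilon> n)) \<longlonglongrightarrow> ?f a t"
    using X.traj_tendsto[OF \<open>0 \<le> t\<close> fr bX] by blast
  obtain \<theta> where \<theta>: "\<And>n. 0 \<le> \<theta> n" "\<theta> \<longlonglongrightarrow> 0"
    "\<And>\<epsilon>. (\<And>n. \<theta> n \<le> \<epsilon> n) \<Longrightarrow> \<epsilon> \<longlonglongrightarrow> 0 \<Longrightarrow> (\<lambda>n. ?g (?g y (r n)) (t + \<epsilon> n)) \<longlonglongrightarrow> ?g (h a) t"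
    using Y.traj_tendsto[OF \<open>0 \<le> t\<close> gr bY] by blast
  \<comment> \<open>The sum dominates both thresholds, so one sequence of times
    \<open>r n + (t + \<epsilon> n)\<close> serves in both systems.\<close>
  define \<epsilon> where "\<epsilon> n = \<eta> n + \<theta> n" for n
  have \<epsilon>: "\<eta> n \<le> \<epsilon> n" "\<theta> n \<le> \<epsilon> n" "0 \<le> t + \<epsilon> n" for n
    using \<eta>(1)[of n] \<theta>(1)[of n] \<open>0 \<le> t\<close> by (auto simp: \<epsilon>_def)
  have "\<epsilon> \<longlonglongrightarrow> 0"
    unfolding \<epsilon>_def using tendsto_add[OF \<eta>(2) \<theta>(2)] by simp
  have times: "time_seq (\<lambda>n. r n + (t + \<epsilon> n))"
    using r \<epsilon>(3) by (rule time_seq_add)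
  have ft: "(\<lambda>n. ?f x (r n + (t + \<epsilon> n))) \<longlonglongrightarrow> ?f a t"
    using \<eta>(3)[OF \<epsilon>(1) \<open>\<epsilon> \<longlonglongrightarrow> 0\<close>] by (simp add: X.traj_semigroup r_nonneg \<epsilon>(3))
  have "(\<lambda>n. ?g y (r n + (t + \<epsilon> n))) \<longlonglongrightarrow> ?g (h a) t"
    using \<theta>(3)[OF \<epsilon>(2) \<open>\<epsilon> \<longlonglongrightarrow> 0\<close>] by (simp add: Y.traj_semigroup r_nonneg \<epsilon>(3))
  with h[OF times ft] have "h (?f a t) = ?g (h a) t"
    by (rule LIMSEQ_unique)
  with times ft show ?thesis
    unfolding limit_points_def by blast
qed

theorem corollary4p10:
  fixes \<pi> :: "'x::metric_space \<Rightarrow> real \<Rightarrow> 'x" and MX :: "'x set" and IX :: "'x \<Rightarrow> 'x"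
    and \<sigma> :: "'y::metric_space \<Rightarrow> real \<Rightarrow> 'y" and MY :: "'y set" and IY :: "'y \<Rightarrow> 'y"
    and x :: 'x and y :: 'y
  assumes "standing_impulsive_system \<pi> MX IX"
    and "standing_impulsive_system \<sigma> MY IY"
    and "pos_limit_set \<pi> MX IX x \<noteq> {}"
    and "impulse_invariant MX IX (pos_limit_set \<pi> MX IX x)"
    and "conv_times \<pi> MX IX x = conv_times \<sigma> MY IY y"
  shows "\<exists>h. weak_top_conjugation \<pi> MX IX \<sigma> MY IY
               (pos_limit_set \<pi> MX IX x) (pos_limit_set \<sigma> MY IY y) h"
proof -
  interpret X: standing_impulsive_system \<pi> MX IX by fact
  let ?A = "pos_limit_set \<pi> MX IX x" and ?B = "pos_limit_set \<sigma> MY IY y"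
  have "convergent (\<lambda>n. imp_traj \<pi> MX IX x (r n)) \<longleftrightarrow> convergent (\<lambda>n. imp_traj \<sigma> MY IY y (r n))"
    if "time_seq r" for r
    using that assms(5) unfolding conv_times_def time_seq_def by blast
  then obtain h k where hom: "homeomorphism ?A ?B h k"
    and h: "\<And>r q. time_seq r \<Longrightarrow> (\<lambda>n. imp_traj \<pi> MX IX x (r n)) \<longlonglongrightarrow> q \<Longrightarrow>
      (\<lambda>n. imp_traj \<sigma> MY IY y (r n)) \<longlonglongrightarrow> h q"
    unfolding pos_limit_set_eq
    using homeomorphism_limit_points[of "imp_traj \<pi> MX IX x" "imp_traj \<sigma> MY IY y"] by blast
  have conj: "imp_traj \<pi> MX IX a t \<in> ?A \<and> h (imp_traj \<pi> MX IX a t) = imp_traj \<sigma> MY IY (h a) t"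
    if "a \<in> ?A" "a \<notin> MX" "0 \<le> t" for a t
    unfolding pos_limit_set_eq
    by (rule limit_map_conjugates[where y = y, OF assms(1,2)])
      (use h that in \<open>simp_all add: pos_limit_set_eq\<close>)
  \<comment> \<open>Invariance and the disjointness of \<open>MX\<close> from its image reduce the
    clause for points of \<open>MX\<close> to \<open>conj\<close> at \<open>IX a\<close>.\<close>
  have "IX a \<in> ?A" "IX a \<notin> MX" if "a \<in> ?A \<inter> MX" for a
    using that assms(4) X.M_disjoint_image unfolding impulse_invariant_def by auto
  with conj hom show ?thesis
    unfolding weak_top_conjugation_def by (intro exI[of _ h]) blast
qed

end
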